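(* For any $m\in\mathbb Z^+$, $j\in\mathbb N_0$ and $a\in\mathbb C$ the following identity holds: $$\sum_{r=0}^j\binom jr\frac{a^r}{j+m-r}=\frac1{m\binom{j+m}m}\left((-1)^ma^{m+j}+(a+1)^{j+1}\sum_{r=0}^{m-1}\binom{j+r}j(-a)^{m-1-r}\right).$$
   Context: Convention: $0^0=1$. *)

theory Defs
  imports Complex_Main
begin

end

theory Submission
  imports Defs
begin

text \<open>Write \<open>I m\<close> for the left-hand side, which is the integral of \<open>x^(m-1) (x+a)^j\<close> over
  \<open>[0,1]\<close>. Integrating the derivative of \<open>x^m (x+a)^(j+1)\<close> gives
  \<open>(m+j+1) I (m+1) + m a I m = (a+1)^(j+1)\<close>. The right-hand side satisfies the same recurrence, and
  both sides agree for \<open>m = 1\<close>. Comparing coefficients of powers of \<open>a\<close> proves the recurrence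
  without integrals.\<close>

definition binomial_moment :: "'a::field_char_0 \<Rightarrow> nat \<Rightarrow> nat \<Rightarrow> 'a" where
  "binomial_moment a j m = (\<Sum>r\<le>j. of_nat (j choose r) * (a ^ r / of_nat (j + m - r)))"

text \<open>For \<open>r \<le> j\<close>, absorption turns
  \<open>(j + 1) * (j choose r) / (j + 1 - r)\<close> into \<open>Suc j choose r\<close>. The sum is
  therefore the expansion of \<open>(a + 1) ^ (j + 1)\<close> without its top term
  \<open>a ^ (j + 1)\<close>.\<close>

lemma binomial_moment_1:
  "of_nat (j + 1) * binomial_moment a j 1 = (a + 1) ^ (j + 1) - a ^ (j + 1)"
proof -
  have coeff: "of_nat (j + 1) * (of_nat (j choose r) * (a ^ r / of_nat (j + 1 - r)))
      = of_nat (Suc j choose r) * a ^ r" if "r \<le> j" for r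
  proof -
    have "(j + 1) * (j choose r) = (j + 1 - r) * (Suc j choose r)"
      using binomial_absorb_comp[of "Suc j" r] by simp
    then have "(of_nat (j + 1) * of_nat (j choose r) :: 'a)
        = of_nat (j + 1 - r) * of_nat (Suc j choose r)"
      by (metis of_nat_mult)
    moreover have "(of_nat (j + 1 - r) :: 'a) \<noteq> 0"
      using that by (simp only: of_nat_eq_0_iff)
    ultimately show ?thesis
      by (simp add: divide_simps mult_ac del: of_nat_Suc of_nat_add of_nat_diff binomial_Suc_Suc)
  qed
  have "of_nat (j + 1) * binomial_moment a j 1 = (\<Sum>r\<le>j. of_nat (Suc j choose r) * a ^ r)"
    unfolding binomial_moment_def sum_distrib_left by (intro sum.cong refl coeff) simp
  also have "\<dots> = (a + 1) ^ Suc j - a ^ Suc j"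
    unfolding binomial_ring[of a 1 "Suc j"] by simp
  finally show ?thesis by simp
qed

text \<open>Splitting the factors \<open>j + m + 1\<close> and \<open>m\<close> along the
  denominators leaves multiples of the expansion of \<open>(a + 1) ^ j\<close>, namely 1 and
  \<open>a\<close> times it, plus two remainders \<open>u\<close> and \<open>v\<close> that cancel
  after an index shift.\<close>

lemma binomial_moment_Suc:
  assumes "m \<ge> 1"
  shows "of_nat (j + m + 1) * binomial_moment a j (Suc m) + of_nat m * a * binomial_moment a j m
    = (a + 1) ^ (j + 1)"
proof -
  define u where
    "u r = of_nat (j choose r) * a ^ r * (of_nat r / of_nat (j + Suc m - r))" for r
  define v where
    "v r = of_nat (j choose r) * a ^ Suc r * (of_nat (j - r) / of_nat (j + m - r))" for r
  \<comment> \<open>The denominators agree, since \<open>j + Suc m - Suc r = j + m - r\<close>; the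
    numerators agree by absorption.\<close>
  have uv: "u (Suc r) = v r" if "r < j" for r
  proof -
    have "Suc r * (j choose Suc r) = (j - r) * (j choose r)"
      using that by (metis binomial_absorb_comp binomial_absorption mult.commute)
    then have "(of_nat (Suc r) * of_nat (j choose Suc r) :: 'a) = of_nat (j - r) * of_nat (j choose r)"
      by (metis of_nat_mult)
    then show ?thesis
      unfolding u_def v_def by (simp add: mult_ac del: of_nat_Suc)
  qed
  \<comment> \<open>The shift loses nothing at the ends: \<open>u 0 = 0\<close> because of the
    factor \<open>r\<close>, and \<open>v j = 0\<close> because of the factor
    \<open>j - r\<close>.\<close>
  have "(\<Sum>r\<le>j. u r) = (\<Sum>r\<le>j. v r)"
  proof (cases j)
    case (Suc k)
    have "(\<Sum>r\<le>j. u r) = u 0 + (\<Sum>r\<le>k. u (Suc r))"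
      unfolding Suc by (rule sum.atMost_Suc_shift)
    also have "\<dots> = (\<Sum>r\<le>k. v r)"
      using Suc by (simp add: u_def[of 0] uv)
    finally show ?thesis by (simp add: Suc v_def[of "Suc k"])
  qed (simp add: u_def v_def)
  \<comment> \<open>Write \<open>j + m + 1 = (j + Suc m - r) + r\<close>: the first part cancels the
    denominator, the second yields \<open>u r\<close>.\<close>
  moreover have "of_nat (j + m + 1) * binomial_moment a j (Suc m)
      = (\<Sum>r\<le>j. of_nat (j choose r) * a ^ r) + (\<Sum>r\<le>j. u r)"
    unfolding binomial_moment_def sum_distrib_left sum.distrib[symmetric]
  proof (rule sum.cong)
    fix r assume "r \<in> {..j}"
    then have "(of_nat (j + m + 1) :: 'a) = of_nat (j + Suc m - r) + of_nat r"
      "(of_nat (j + Suc m - r) :: 'a) \<noteq> 0"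
      by (simp flip: of_nat_add, simp only: of_nat_eq_0_iff, simp)
    then show "of_nat (j + m + 1) * (of_nat (j choose r) * (a ^ r / of_nat (j + Suc m - r)))
        = of_nat (j choose r) * a ^ r + u r"
      unfolding u_def by (simp add: field_simps del: of_nat_Suc of_nat_add)
  qed simp
  \<comment> \<open>Now \<open>(j - r) + m\<close> is the denominator itself;
    \<open>m \<ge> 1\<close> keeps it nonzero at \<open>r = j\<close>.\<close>
  moreover have "(\<Sum>r\<le>j. v r) + of_nat m * a * binomial_moment a j m
      = a * (\<Sum>r\<le>j. of_nat (j choose r) * a ^ r)"
    unfolding binomial_moment_def sum_distrib_left sum.distrib[symmetric]
  proof (rule sum.cong)
    fix r assume "r \<in> {..j}"
    then have "(of_nat (j + m - r) :: 'a) = of_nat (j - r) + of_nat m"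
      "(of_nat (j + m - r) :: 'a) \<noteq> 0"
      using assms by (simp flip: of_nat_add, simp only: of_nat_eq_0_iff, simp)
    then show "v r + of_nat m * a * (of_nat (j choose r) * (a ^ r / of_nat (j + m - r)))
        = a * (of_nat (j choose r) * a ^ r)"
      unfolding v_def by (simp add: divide_simps del: of_nat_Suc of_nat_add) (simp add: algebra_simps)
  qed simp
  moreover have "(a + 1) ^ j = (\<Sum>r\<le>j. of_nat (j choose r) * a ^ r)"
    by (simp add: binomial_ring)
  ultimately show ?thesis by (simp add: algebra_simps)
qed

text \<open>Induction on \<open>m\<close> along the recurrence. Clearing the denominator and
  starting at \<open>Suc m\<close> avoids both division and the truncated
  \<open>m - 1\<close>.\<close>

lemma binomial_moment_closed_form:
  "of_nat (Suc m) * of_nat ((j + Suc m) choose Suc m) * binomial_moment a j (Suc m) =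
    (-1) ^ Suc m * a ^ (Suc m + j) +
      (a + 1) ^ (j + 1) * (\<Sum>r\<le>m. of_nat ((j + r) choose j) * (- a) ^ (m - r))"
proof (induction m)
  case 0
  then show ?case using binomial_moment_1[of j a] by simp
next
  case (Suc m)
  define S where "S m = (\<Sum>r\<le>m. of_nat ((j + r) choose j) * (- a) ^ (m - r))" for m
  let ?n = "Suc m" and ?I = "binomial_moment a j"
  let ?C = "of_nat ((j + ?n) choose ?n) :: 'a"
  \<comment> \<open>Every old summand gains a factor \<open>- a\<close>; the new index
    \<open>r = ?n\<close> contributes \<open>?C\<close> by symmetry of the binomial
    coefficient.\<close>
  have S: "S ?n = - a * S m + ?C"
  proof -
    have "(\<Sum>r\<le>m. of_nat ((j + r) choose j) * (- a) ^ (?n - r)) = - a * S m"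
      unfolding S_def sum_distrib_left by (intro sum.cong) (auto simp: Suc_diff_le)
    moreover have "(j + ?n) choose j = (j + ?n) choose ?n"
      using binomial_symmetric[of j "j + ?n"] by simp
    ultimately show ?thesis unfolding S_def[of ?n] by simp
  qed
  have IH: "of_nat ?n * ?C * ?I ?n = (-1) ^ ?n * a ^ (?n + j) + (a + 1) ^ (j + 1) * S m"
    using Suc.IH unfolding S_def .
  have "Suc ?n * ((j + Suc ?n) choose Suc ?n) = (j + ?n + 1) * ((j + ?n) choose ?n)"
    using Suc_times_binomial_eq[of "j + ?n" ?n] by (simp add: mult.commute)
  then have "of_nat (Suc ?n) * of_nat ((j + Suc ?n) choose Suc ?n) = of_nat (j + ?n + 1) * ?C"
    by (metis of_nat_mult)
  then have "of_nat (Suc ?n) * of_nat ((j + Suc ?n) choose Suc ?n) * ?I (Suc ?n)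
      = ?C * (of_nat (j + ?n + 1) * ?I (Suc ?n))"
    by (simp only: mult_ac)
  also have "\<dots> = ?C * ((a + 1) ^ (j + 1) - of_nat ?n * a * ?I ?n)"
    using binomial_moment_Suc[of ?n j a]
    by (simp add: eq_diff_eq del: of_nat_Suc of_nat_add binomial_Suc_Suc)
  also have "\<dots> = ?C * (a + 1) ^ (j + 1) - a * (of_nat ?n * ?C * ?I ?n)"
    by (simp only: right_diff_distrib mult_ac)
  \<comment> \<open>After inserting \<open>IH\<close>, the terms with
    \<open>(a + 1) ^ (j + 1)\<close> combine to \<open>?C - a * S m\<close>, which is
    \<open>S ?n\<close>.\<close>
  also have "\<dots> = (-1) ^ Suc ?n * a ^ (Suc ?n + j) + (a + 1) ^ (j + 1) * S ?n"
    unfolding IH S by (simp add: algebra_simps del: of_nat_Suc binomial_Suc_Suc)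
  finally show ?case unfolding S_def .
qed

theorem proposition10p1:
  fixes m j :: nat and a :: complex
  assumes "m \<ge> 1"
  shows "(\<Sum>r=0..j. of_nat (j choose r) * (a ^ r / (of_nat j + of_nat m - of_nat r))) =
    1 / (of_nat m * of_nat ((j + m) choose m)) *
      ((-1) ^ m * a ^ (m + j) +
       (a + 1) ^ (j + 1) * (\<Sum>r=0..m-1. of_nat ((j + r) choose j) * (- a) ^ (m - 1 - r)))"
proof -
  obtain n where m: "m = Suc n" using assms by (cases m) auto
  \<comment> \<open>Complex subtraction matches the subtraction of naturals in
    \<open>binomial_moment\<close> because \<open>r \<le> j\<close>.\<close>
  have lhs: "(\<Sum>r=0..j. of_nat (j choose r) * (a ^ r / (of_nat j + of_nat m - of_nat r)))
      = binomial_moment a j m"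
    unfolding binomial_moment_def by (rule sum.cong) (auto simp: of_nat_diff)
  have "of_nat m * of_nat ((j + m) choose m) \<noteq> (0 :: complex)"
    unfolding m by (simp del: of_nat_Suc binomial_Suc_Suc)
  then show ?thesis
    unfolding lhs using binomial_moment_closed_form[of n j a]
    by (simp add: m atLeast0AtMost field_simps del: of_nat_Suc binomial_Suc_Suc)
qed

end
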